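(* Let $G$ be a connected, triangle-free, $r$-regular graph with $r\geq 2$, having $p$ vertices and $q$ edges, and let $r=\lambda_1>\lambda_2\geq\cdots\geq\lambda_p$ be the eigenvalues of the adjacency matrix $A(G)$. Then the eigenvalues of the eccentricity matrix $\epsilon(C[G])$ of the central graph $C[G]$, counted with multiplicity, are: (1) $3$, with multiplicity $q-p$; (2) for each $i=2,\ldots,p$, the two numbers $\frac{(3-(3r+\lambda_i))\pm\sqrt{(5\lambda_i+3(r-1))^2+16(\lambda_i+r)}}{2}$; (3) the two numbers $\frac{(3q-4r+3)\pm\sqrt{(3q-8r+3)^2+16(p-2)(q-r)}}{2}$.
   Context: All graphs are finite, simple, undirected and connected. For a connected graph $H$ with vertices $v_1,\ldots,v_n$, $d(v_i,v_j)$ is the distance and $e(v_i)=\max_j d(v_i,v_j)$ is the eccentricity of $v_i$. The eccentricity matrix $\epsilon(H)$ is the $n\times n$ matrix whose $(i,j)$ entry is $d(v_i,v_j)$ if $d(v_i,v_j)=\min\{e(v_i),e(v_j)\}$ and $0$ otherwise. The central graph $C[G]$ of a graph $G$ has vertex set $V(G)\cup I(G)$, where $I(G)=\{w_e: e\in E(G)\}$ contains one new vertex for each edge of $G$; its edges are $u w_e$ for each edge $e$ of $G$ and each endpoint $u$ of $e$, and $uv$ for every pair of distinct vertices $u,v\in V(G)$ that are nonadjacent in $G$ (the original edges of $G$ are not edges of $C[G]$). *)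

theory Defs
  imports "Jordan_Normal_Form.Char_Poly"
begin

text \<open>Edges are unordered pairs, represented as two-element sets of vertices.\<close>

datatype 'a graph = Graph (verts: "'a set") (edges: "'a set set")

definition simple_graph :: "'a graph \<Rightarrow> bool" where
  "simple_graph G \<longleftrightarrow>
     finite (verts G) \<and> (\<forall>e\<in>edges G. e \<subseteq> verts G \<and> card e = 2)"

definition adj :: "'a graph \<Rightarrow> 'a \<Rightarrow> 'a \<Rightarrow> bool" where
  "adj G u v \<longleftrightarrow> {u, v} \<in> edges G"

definition connected_graph :: "'a graph \<Rightarrow> bool" where
  "connected_graph G \<longleftrightarrow>
     verts G \<noteq> {} \<and> (\<forall>u\<in>verts G. \<forall>v\<in>verts G. (adj G)\<^sup>*\<^sup>* u v)"

definition regular_graph :: "'a graph \<Rightarrow> nat \<Rightarrow> bool" where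
  "regular_graph G r \<longleftrightarrow> (\<forall>v\<in>verts G. card {u \<in> verts G. adj G v u} = r)"

definition triangle_free :: "'a graph \<Rightarrow> bool" where
  "triangle_free G \<longleftrightarrow> \<not> (\<exists>u v w. adj G u v \<and> adj G v w \<and> adj G u w)"

text \<open>The relation power \<open>(adj G ^^ n) u v\<close> says that there is a walk of length \<open>n\<close> from \<open>u\<close>
  to \<open>v\<close>. The distance is meaningful only between vertices of a connected graph.\<close>

definition gdist :: "'a graph \<Rightarrow> 'a \<Rightarrow> 'a \<Rightarrow> nat" where
  "gdist G u v = (LEAST n. (adj G ^^ n) u v)"

definition eccentricity :: "'a graph \<Rightarrow> 'a \<Rightarrow> nat" where
  "eccentricity G u = Max {gdist G u v | v. v \<in> verts G}"

definition vertex_enum :: "'a graph \<Rightarrow> 'a list \<Rightarrow> bool" where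
  "vertex_enum G vs \<longleftrightarrow> distinct vs \<and> set vs = verts G"

definition adjacency_matrix :: "'a graph \<Rightarrow> 'a list \<Rightarrow> real mat" where
  "adjacency_matrix G vs = mat (length vs) (length vs)
     (\<lambda>(i, j). if adj G (vs ! i) (vs ! j) then 1 else 0)"

definition eccentricity_matrix :: "'a graph \<Rightarrow> 'a list \<Rightarrow> real mat" where
  "eccentricity_matrix G vs = mat (length vs) (length vs)
     (\<lambda>(i, j). if gdist G (vs ! i) (vs ! j)
                    = min (eccentricity G (vs ! i)) (eccentricity G (vs ! j))
               then real (gdist G (vs ! i) (vs ! j)) else 0)"

text \<open>The vertices of the central graph are the \<open>Inl v\<close> for vertices \<open>v\<close> of \<open>G\<close> and, for each
  edge \<open>e\<close> of \<open>G\<close>, the new vertex \<open>Inr e\<close>.\<close>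

definition central_graph :: "'a graph \<Rightarrow> ('a + 'a set) graph" where
  "central_graph G = Graph
     (Inl ` verts G \<union> Inr ` edges G)
     ({{Inl u, Inr e} | u e. e \<in> edges G \<and> u \<in> e}
      \<union> {{Inl u, Inl v} | u v. u \<in> verts G \<and> v \<in> verts G \<and> u \<noteq> v \<and> \<not> adj G u v})"

text \<open>Real eigenvalues with algebraic multiplicity. All eigenvalues of a real symmetric matrix
  are real, so for the matrices above this is the complete spectrum.\<close>

definition eigenvalue_mset :: "real mat \<Rightarrow> real multiset" where
  "eigenvalue_mset A = proots (char_poly A)"

end

theory Submission
  imports Defs
begin

text \<open>Let \<open>n = p + q\<close> and let \<open>M\<close> be the eccentricity matrix. Distances in the central graph are at
  most 3, and \<open>M - 3 I\<close> factors as \<open>L S\<close> with \<open>L\<close> of size \<open>n \<times> 2p\<close> and \<open>S\<close> of size \<open>2p \<times> n\<close>. By Sylvester's determinant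
  identity \<open>det (y I - L S) = y ^ (q - p) * det (y I - S L)\<close>, which accounts for the eigenvalue 3.
  The four \<open>p \<times> p\<close> blocks of \<open>S L\<close> are linear combinations of \<open>A\<close>, \<open>I\<close> and the all-ones matrix \<open>J\<close>.
  They commute because \<open>G\<close> is regular, so the determinant of \<open>y I - S L\<close> is that of a quadratic
  polynomial in \<open>A\<close> plus a multiple of \<open>J\<close>, and it splits over the eigenvalues of \<open>A\<close>.\<close>

section \<open>Determinant identities and split polynomials\<close>

text \<open>\<open>Y\<close> on the right and \<open>Z\<close> on the left both clear the lower left
  block of \<open>X\<close>, so \<open>det X\<close> is computed in two ways. Keeping powers of
  \<open>y\<close> on both sides avoids dividing by \<open>y\<close> and comparing \<open>n\<close>
  with \<open>m\<close>.\<close>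

lemma sylvester_det_identity:
  fixes L S :: "'a :: field mat"
  assumes L: "L \<in> carrier_mat n m" and S: "S \<in> carrier_mat m n"
  shows "y ^ m * det (y \<cdot>\<^sub>m 1\<^sub>m n - L * S) = y ^ n * det (y \<cdot>\<^sub>m 1\<^sub>m m - S * L)"
proof -
  define X where "X = four_block_mat (y \<cdot>\<^sub>m 1\<^sub>m n) L S (1\<^sub>m m)"
  define Y where "Y = four_block_mat (1\<^sub>m n) (0\<^sub>m n m) (- S) (1\<^sub>m m)"
  define Z where "Z = four_block_mat (1\<^sub>m n) (0\<^sub>m n m) (- S) (y \<cdot>\<^sub>m 1\<^sub>m m)"
  have X: "X \<in> carrier_mat (n + m) (n + m)" and Y: "Y \<in> carrier_mat (n + m) (n + m)"
    and Z: "Z \<in> carrier_mat (n + m) (n + m)"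
    unfolding X_def Y_def Z_def using L S by auto
  have "X * Y = four_block_mat (y \<cdot>\<^sub>m 1\<^sub>m n - L * S) L (0\<^sub>m m n) (1\<^sub>m m)"
    unfolding X_def Y_def
    by (subst mult_four_block_mat[where ?nr1.0 = n and ?n1.0 = n and ?n2.0 = m and ?nr2.0 = m
        and ?nc1.0 = n and ?nc2.0 = m])
       (use L S in \<open>auto intro!: cong_four_block_mat eq_matI\<close>)
  moreover have "det \<dots> = det (y \<cdot>\<^sub>m 1\<^sub>m n - L * S) * det (1\<^sub>m m :: 'a mat)"
    using L S by (intro det_four_block_mat_lower_left_zero) auto
  moreover have "det Y = det (1\<^sub>m n :: 'a mat) * det (1\<^sub>m m :: 'a mat)"
    unfolding Y_def using S by (intro det_four_block_mat_upper_right_zero) auto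
  ultimately have 1: "det X = det (y \<cdot>\<^sub>m 1\<^sub>m n - L * S)"
    using det_mult[OF X Y] by simp
  have "Z * X = four_block_mat (y \<cdot>\<^sub>m 1\<^sub>m n) L (0\<^sub>m m n) (y \<cdot>\<^sub>m 1\<^sub>m m - S * L)"
    unfolding X_def Z_def
    by (subst mult_four_block_mat[where ?nr1.0 = n and ?n1.0 = n and ?n2.0 = m and ?nr2.0 = m
        and ?nc1.0 = n and ?nc2.0 = m])
       (use L S in \<open>auto intro!: cong_four_block_mat eq_matI\<close>)
  moreover have "det \<dots> = det (y \<cdot>\<^sub>m 1\<^sub>m n :: 'a mat) * det (y \<cdot>\<^sub>m 1\<^sub>m m - S * L)"
    using L S by (intro det_four_block_mat_lower_left_zero) auto
  moreover have "det Z = det (1\<^sub>m n :: 'a mat) * det (y \<cdot>\<^sub>m 1\<^sub>m m :: 'a mat)"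
    unfolding Z_def using S by (intro det_four_block_mat_upper_right_zero) auto
  ultimately have "y ^ m * det X = y ^ n * det (y \<cdot>\<^sub>m 1\<^sub>m m - S * L)"
    using det_mult[OF Z X] by (simp add: det_smult)
  then show ?thesis
    unfolding 1 .
qed

text \<open>The perturbation of the identity has rank one, so the identity above at
  \<open>y = 1\<close> reduces the determinant to size 1.\<close>

lemma det_one_plus_all_ones:
  fixes c :: "'a :: field"
  shows "det (mat p p (\<lambda>(i, j). of_bool (i = j) + c)) = 1 + of_nat p * c"
proof -
  define u :: "'a mat" where "u = mat p 1 (\<lambda>_. - c)"
  define v :: "'a mat" where "v = mat 1 p (\<lambda>_. 1)"
  have u: "u \<in> carrier_mat p 1" and v: "v \<in> carrier_mat 1 p"
    by (auto simp: u_def v_def)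
  have "1 \<cdot>\<^sub>m 1\<^sub>m p - u * v = mat p p (\<lambda>(i, j). of_bool (i = j) + c)"
    by (intro eq_matI) (auto simp: u_def v_def scalar_prod_def)
  moreover have "1 \<cdot>\<^sub>m 1\<^sub>m 1 - v * u = mat 1 1 (\<lambda>_. 1 + of_nat p * c)"
    by (intro eq_matI) (auto simp: u_def v_def scalar_prod_def)
  ultimately show ?thesis
    using sylvester_det_identity[OF u v, of 1] by (simp add: det_single)
qed

text \<open>The size assumption says that the polynomial splits. The induction strips off one root
  with its full multiplicity at a time. This recovers a characteristic polynomial from its
  eigenvalue multiset.\<close>

lemma poly_eq_smult_prod_proots:
  fixes p :: "'a :: idom poly"
  assumes "size (proots p) = degree p"
  shows "p = Polynomial.smult (lead_coeff p) (\<Prod>x\<in>#proots p. [:- x, 1:])"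
  using assms
proof (induction p rule: poly_root_order_induct)
  case (no_roots p)
  then have "proots p = {#}"
    by (simp add: multiset_eqI order_root)
  with no_roots.prems show ?case
    by (auto elim!: degree_eq_zeroE)
next
  case (root p x n)
  have [simp]: "p \<noteq> 0"
    using root.hyps by auto
  have "size (proots p) = degree p"
    using root.prems by (simp add: proots_mult proots_power degree_mult_eq degree_power_eq)
  note IH = root.IH[OF this]
  have "lead_coeff ([:- x, 1:] ^ n * p) = lead_coeff p"
    by (simp add: lead_coeff_mult lead_coeff_power)
  moreover have "(\<Prod>z\<in>#repeat_mset n {#x#}. [:- z, 1:]) = [:- x, 1:] ^ n"
    by (induction n) auto
  ultimately show ?case
    using IH by (simp add: proots_mult proots_power mult_ac flip: mult_smult_right)
qed auto

section \<open>Short distances and the edges of the central graph\<close>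

lemma relpowp_2_iff: "(R ^^ 2) x y \<longleftrightarrow> (\<exists>z. R x z \<and> R z y)"
  by (auto simp: numeral_2_eq_2 relcompp_apply)

lemma gdist_self: "gdist G x x = 0"
  unfolding gdist_def by (rule Least_eq_0) simp

lemma gdist_eq_1:
  assumes "adj G x y" "x \<noteq> y"
  shows "gdist G x y = Suc 0"
  unfolding gdist_def
proof (rule Least_equality)
  show "(adj G ^^ Suc 0) x y"
    using assms by (auto simp: relcompp_apply)
  show "Suc 0 \<le> n" if "(adj G ^^ n) x y" for n
    using that assms(2) by (cases n) auto
qed

lemma gdist_eq_2:
  assumes "adj G x z" "adj G z y" "\<not> adj G x y" "x \<noteq> y"
  shows "gdist G x y = 2"
  unfolding gdist_def
proof (rule Least_equality)
  show "(adj G ^^ 2) x y"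
    using assms(1,2) by (auto simp: relpowp_2_iff)
  show "2 \<le> n" if "(adj G ^^ n) x y" for n
  proof (rule ccontr)
    assume "\<not> 2 \<le> n"
    then have "n = 0 \<or> n = 1" by auto
    with that assms(3,4) show False by auto
  qed
qed

lemma gdist_eq_3:
  assumes "adj G x z" "adj G z w" "adj G w y"
    and "\<not> (\<exists>z. adj G x z \<and> adj G z y)" "\<not> adj G x y" "x \<noteq> y"
  shows "gdist G x y = 3"
  unfolding gdist_def
proof (rule Least_equality)
  show "(adj G ^^ 3) x y"
    using assms(1-3) by (auto simp: numeral_3_eq_3 relcompp_apply)
  show "3 \<le> n" if "(adj G ^^ n) x y" for n
  proof (rule ccontr)
    assume "\<not> 3 \<le> n"
    then have "n = 0 \<or> n = 1 \<or> n = 2" by auto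
    with that assms(4-6) show False by (auto simp: relpowp_2_iff)
  qed
qed

lemma eccentricity_eqI:
  assumes "finite (verts G)" "\<And>v. v \<in> verts G \<Longrightarrow> gdist G u v \<le> k"
    and "v \<in> verts G" "gdist G u v = k"
  shows "eccentricity G u = k"
  unfolding eccentricity_def using assms by (intro Max_eqI) auto

lemma verts_central_graph: "verts (central_graph G) = Inl ` verts G \<union> Inr ` edges G"
  by (simp add: central_graph_def)

lemma adj_central_graph:
  "adj (central_graph G) (Inl u) (Inl v) \<longleftrightarrow> u \<in> verts G \<and> v \<in> verts G \<and> u \<noteq> v \<and> \<not> adj G u v"
  "adj (central_graph G) (Inl u) (Inr e) \<longleftrightarrow> e \<in> edges G \<and> u \<in> e"
  "adj (central_graph G) (Inr e) (Inl u) \<longleftrightarrow> e \<in> edges G \<and> u \<in> e"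
  "\<not> adj (central_graph G) (Inr e) (Inr f)"
  by (auto simp: adj_def central_graph_def doubleton_eq_iff insert_commute)

section \<open>Counting in a regular triangle-free graph\<close>

locale regular_triangle_free =
  fixes G :: "'a graph" and r p q :: nat
  assumes simple: "simple_graph G" and nonempty: "verts G \<noteq> {}"
    and tri: "triangle_free G" and reg: "regular_graph G r" and r2: "r \<ge> 2"
    and p: "p = card (verts G)" and q: "q = card (edges G)"
begin

abbreviation "V \<equiv> verts G"
abbreviation "E \<equiv> edges G"
abbreviation "C \<equiv> central_graph G"

lemma finite_V: "finite V"
  using simple by (simp add: simple_graph_def)

lemma finite_E: "finite E"
  by (rule finite_subset[of _ "Pow V"]) (use simple finite_V in \<open>auto simp: simple_graph_def\<close>)

lemma edge_subset: "e \<in> E \<Longrightarrow> e \<subseteq> V"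
  and card_edge: "e \<in> E \<Longrightarrow> card e = 2"
  using simple by (auto simp: simple_graph_def)

lemma finite_edge: "e \<in> E \<Longrightarrow> finite e"
  using edge_subset finite_V finite_subset by blast

lemma edgeE:
  assumes "e \<in> E"
  obtains a b where "e = {a, b}" "a \<noteq> b" "a \<in> V" "b \<in> V" "adj G a b" "adj G b a"
proof -
  obtain a b where "e = {a, b}" "a \<noteq> b"
    using card_edge[OF assms] by (auto simp: card_2_iff)
  with assms edge_subset[OF assms] show ?thesis
    by (auto intro!: that simp: adj_def insert_commute)
qed

lemma adj_sym: "adj G u v \<longleftrightarrow> adj G v u"
  by (simp add: adj_def insert_commute)

lemma adj_irrefl: "\<not> adj G u u"
  using card_edge[of "{u}"] by (auto simp: adj_def)

lemma no_triangle: "adj G u v \<Longrightarrow> adj G v w \<Longrightarrow> \<not> adj G u w"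
  using tri by (auto simp: triangle_free_def)

lemma degree_eq: "v \<in> V \<Longrightarrow> card {u \<in> V. adj G v u} = r"
  using reg by (simp add: regular_graph_def)

lemma other_neighbour:
  assumes "v \<in> V"
  obtains w where "adj G v w" "w \<noteq> x" "w \<in> V"
proof -
  have "\<not> {u \<in> V. adj G v u} \<subseteq> {x}"
    using card_mono[of "{x}" "{u \<in> V. adj G v u}"] degree_eq[OF assms] r2 by auto
  then show ?thesis
    using that by auto
qed

lemma card_incident_edges:
  assumes "v \<in> V"
  shows "card {e \<in> E. v \<in> e} = r"
proof -
  have "bij_betw (\<lambda>u. {v, u}) {u \<in> V. adj G v u} {e \<in> E. v \<in> e}"
    unfolding bij_betw_def
  proof
    show "inj_on (\<lambda>u. {v, u}) {u \<in> V. adj G v u}"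
      by (auto simp: inj_on_def doubleton_eq_iff)
    show "(\<lambda>u. {v, u}) ` {u \<in> V. adj G v u} = {e \<in> E. v \<in> e}"
    proof (intro equalityI subsetI)
      fix e assume e: "e \<in> {e \<in> E. v \<in> e}"
      then obtain a b where "e = {a, b}" "a \<in> V" "b \<in> V" "adj G a b" "adj G b a"
        by (auto elim: edgeE)
      with e show "e \<in> (\<lambda>u. {v, u}) ` {u \<in> V. adj G v u}"
        by (auto simp: image_iff insert_commute)
    qed (auto simp: adj_def)
  qed
  then show ?thesis
    using degree_eq[OF assms] bij_betw_same_card by fastforce
qed

lemma card_common_edges:
  assumes "u \<noteq> v"
  shows "card {e \<in> E. u \<in> e \<and> v \<in> e} = (if adj G u v then 1 else 0)"
proof -
  have "{e \<in> E. u \<in> e \<and> v \<in> e} = (if adj G u v then {{u, v}} else {})"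
    using assms by (auto simp: adj_def insert_commute elim!: edgeE)
  then show ?thesis
    by simp
qed

text \<open>Double counting of the incident pairs of a vertex and an edge.\<close>

lemma handshake: "p * r = 2 * q"
proof -
  have "p * r = (\<Sum>v\<in>V. card {e \<in> E. v \<in> e})"
    by (simp add: card_incident_edges p)
  also have "\<dots> = (\<Sum>v\<in>V. \<Sum>e\<in>E. of_bool (v \<in> e))"
    by (simp add: sum.If_cases finite_E of_bool_def Int_def)
  also have "\<dots> = (\<Sum>e\<in>E. \<Sum>v\<in>V. of_bool (v \<in> e))"
    by (rule sum.swap)
  also have "\<dots> = (\<Sum>e\<in>E. card e)"
  proof (rule sum.cong)
    fix e assume "e \<in> E"
    then have "V \<inter> e = e"
      using edge_subset by auto
    then show "(\<Sum>v\<in>V. of_bool (v \<in> e)) = card e"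
      by (simp add: sum.If_cases finite_V of_bool_def)
  qed simp
  also have "\<dots> = 2 * q"
    by (simp add: card_edge q)
  finally show ?thesis .
qed

lemma r_less_p: "r < p"
proof -
  obtain v where v: "v \<in> V"
    using nonempty by auto
  then have "{u \<in> V. adj G v u} \<subset> V"
    using adj_irrefl by auto
  from psubset_card_mono[OF finite_V this] show ?thesis
    by (simp add: degree_eq v p)
qed

text \<open>Guarantees that the natural-number difference \<open>q - p\<close> is not
  truncated.\<close>

lemma p_le_q: "p \<le> q"
  using handshake r2 mult_le_mono2[of 2 r p] by simp

lemma r_le_q: "r \<le> q"
  using r_less_p p_le_q by simp

section \<open>Distances and eccentricities in the central graph\<close>

lemma gdist_Inl_Inl:
  assumes "u \<in> V" "v \<in> V"
  shows "gdist C (Inl u) (Inl v) = (if u = v then 0 else if adj G u v then 2 else 1)"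
proof -
  have "gdist C (Inl u) (Inl v) = 2" if "adj G u v"
    using that adj_irrefl
    by (intro gdist_eq_2[of _ _ "Inr {u, v}"]) (auto simp: adj_central_graph, auto simp: adj_def)
  moreover have "gdist C (Inl u) (Inl v) = 1" if "\<not> adj G u v" "u \<noteq> v"
    using that assms by (simp add: gdist_eq_1 adj_central_graph)
  ultimately show ?thesis
    by (auto simp: gdist_self)
qed

text \<open>A vertex \<open>u\<close> off \<open>e\<close> misses some endpoint \<open>c\<close> of
  \<open>e\<close>, as there are no triangles; the path through \<open>c\<close> has length
  2.\<close>

lemma gdist_incident:
  assumes "u \<in> V" "e \<in> E"
  shows "gdist C (Inl u) (Inr e) = (if u \<in> e then 1 else 2)"
    and "gdist C (Inr e) (Inl u) = (if u \<in> e then 1 else 2)"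
proof -
  from assms(2) obtain a b where ab: "e = {a, b}" "a \<in> V" "b \<in> V" "adj G a b" "adj G b a"
    by (rule edgeE)
  then have "\<exists>c\<in>e. \<not> adj G u c"
    using no_triangle[of u a b] by auto
  then obtain c where c: "c \<in> e" "\<not> adj G u c" "\<not> adj G c u" "c \<in> V"
    using edge_subset[OF assms(2)] adj_sym by blast
  show "gdist C (Inl u) (Inr e) = (if u \<in> e then 1 else 2)"
  proof (cases "u \<in> e")
    case True
    then show ?thesis
      using assms by (auto intro!: gdist_eq_1 simp: adj_central_graph)
  next
    case False
    then show ?thesis
      using assms c by (auto intro!: gdist_eq_2[of _ _ "Inl c"] simp: adj_central_graph)
  qed
  show "gdist C (Inr e) (Inl u) = (if u \<in> e then 1 else 2)"
  proof (cases "u \<in> e")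
    case True
    then show ?thesis
      using assms by (auto intro!: gdist_eq_1 simp: adj_central_graph)
  next
    case False
    then show ?thesis
      using assms c by (auto intro!: gdist_eq_2[of _ _ "Inl c"] simp: adj_central_graph)
  qed
qed

text \<open>The neighbours of an edge vertex are its endpoints, so distance 2 means a common
  endpoint. For disjoint edges, an endpoint \<open>c\<close> of \<open>f\<close> is nonadjacent in
  \<open>G\<close> to some endpoint \<open>d\<close> of \<open>e\<close>, which gives the path
  \<open>e\<close>, \<open>d\<close>, \<open>c\<close>, \<open>f\<close>.\<close>

lemma gdist_Inr_Inr:
  assumes "e \<in> E" "f \<in> E"
  shows "gdist C (Inr e) (Inr f) = (if e = f then 0 else if e \<inter> f = {} then 3 else 2)"
proof (cases "e \<inter> f = {}")
  case True
  from assms(1) obtain a b where ab: "e = {a, b}" "a \<in> V" "b \<in> V" "adj G a b" "adj G b a"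
    by (rule edgeE)
  from assms(2) obtain c where c: "c \<in> f" "c \<in> V"
    by (auto elim: edgeE)
  have "\<exists>d\<in>e. \<not> adj G d c"
    using no_triangle[of a b c] ab by auto
  then obtain d where "d \<in> e" "d \<in> V" "\<not> adj G d c"
    using edge_subset[OF assms(1)] by blast
  moreover from this c True have "d \<noteq> c"
    by auto
  ultimately have "gdist C (Inr e) (Inr f) = 3"
    using assms c True
    by (intro gdist_eq_3[of _ _ "Inl d" "Inl c"])
       (auto simp: adj_central_graph split_sum_ex)
  with True ab(1) show ?thesis
    by auto
next
  case False
  then obtain c where c: "c \<in> e" "c \<in> f"
    by auto
  have "gdist C (Inr e) (Inr f) = 2" if "e \<noteq> f"
    using assms c that by (intro gdist_eq_2[of _ _ "Inl c"]) (auto simp: adj_central_graph)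
  with False show ?thesis
    by (auto simp: gdist_self)
qed

text \<open>Degree at least 2 extends \<open>b\<close>, \<open>a\<close> to a path \<open>b\<close>,
  \<open>a\<close>, \<open>c\<close>, \<open>d\<close>. It cannot close up with
  \<open>d = b\<close>, since that would be a triangle, so the edge \<open>{c, d}\<close> avoids
  \<open>e\<close>.\<close>

lemma ex_disjoint_edge:
  assumes "e \<in> E"
  shows "\<exists>f\<in>E. e \<inter> f = {}"
proof -
  from assms obtain a b where ab: "e = {a, b}" "a \<in> V" "b \<in> V" "adj G a b" "a \<noteq> b"
    by (rule edgeE)
  obtain c where c: "adj G a c" "c \<noteq> b" "c \<in> V"
    using other_neighbour[OF ab(2)] by metis
  obtain d where d: "adj G c d" "d \<noteq> a" "d \<in> V"
    using other_neighbour[OF c(3)] by metis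
  have "d \<noteq> b"
    using no_triangle[OF c(1), of b] d ab by auto
  moreover have "c \<noteq> a"
    using adj_irrefl c by auto
  ultimately have "e \<inter> {c, d} = {}"
    using ab c d by auto
  with d(1) show ?thesis
    by (auto simp: adj_def intro: bexI[of _ "{c, d}"])
qed

lemma eccentricity_Inl:
  assumes "u \<in> V"
  shows "eccentricity C (Inl u) = 2"
proof -
  obtain w where "adj G u w" "w \<noteq> u" "w \<in> V"
    using other_neighbour[OF assms] by metis
  then show ?thesis
    using assms
    by (intro eccentricity_eqI[of _ _ _ "Inl w"])
       (auto simp: finite_V finite_E verts_central_graph gdist_Inl_Inl gdist_incident)
qed

lemma eccentricity_Inr:
  assumes "e \<in> E"
  shows "eccentricity C (Inr e) = 3"
proof -
  obtain f where "f \<in> E" "e \<inter> f = {}"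
    using ex_disjoint_edge[OF assms] by auto
  moreover have "e \<noteq> {}"
    using card_edge[OF assms] by auto
  ultimately show ?thesis
    using assms
    by (intro eccentricity_eqI[of _ _ _ "Inr f"])
       (auto simp: finite_V finite_E verts_central_graph gdist_Inr_Inr gdist_incident split: if_splits)
qed

text \<open>The smaller eccentricity is 3 between two edge vertices and 2 for every other pair, so
  only those distances survive.\<close>

fun ecc_entry :: "'a + 'a set \<Rightarrow> 'a + 'a set \<Rightarrow> real" where
  "ecc_entry (Inl u) (Inl v) = 2 * of_bool (adj G u v)"
| "ecc_entry (Inl u) (Inr e) = 2 * of_bool (u \<notin> e)"
| "ecc_entry (Inr e) (Inl u) = 2 * of_bool (u \<notin> e)"
| "ecc_entry (Inr e) (Inr f) = 3 * of_bool (e \<inter> f = {})"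

lemma eccentricity_matrix_central:
  assumes "set ws = verts C"
  shows "eccentricity_matrix C ws =
    mat (length ws) (length ws) (\<lambda>(i, j). ecc_entry (ws ! i) (ws ! j))"
proof -
  have "{} \<notin> E"
    using card_edge by force
  then have *: "(if gdist C x y = min (eccentricity C x) (eccentricity C y) then real (gdist C x y) else 0)
      = ecc_entry x y" if "x \<in> verts C" "y \<in> verts C" for x y
    using that adj_irrefl
    by (auto simp: verts_central_graph gdist_Inl_Inl gdist_incident gdist_Inr_Inr
        eccentricity_Inl eccentricity_Inr split: if_splits)
  have "ws ! i \<in> verts C" if "i < length ws" for i
    using that assms nth_mem by metis
  then show ?thesis
    unfolding eccentricity_matrix_def by (intro eq_matI) (simp_all add: *)
qed

end

section \<open>Determinants of combinations of \<open>A\<close>, \<open>I\<close> and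
  \<open>J\<close>\<close>

text \<open>The eigenvector equation is compared at a coordinate of largest absolute value.\<close>

lemma abs_eigenvalue_le_row_sum:
  fixes A :: "real mat"
  assumes A: "A \<in> carrier_mat n n" and ev: "eigenvalue A k"
    and rows: "\<And>i. i < n \<Longrightarrow> (\<Sum>j<n. \<bar>A $$ (i, j)\<bar>) \<le> s"
  shows "\<bar>k\<bar> \<le> s"
proof -
  obtain v where v: "v \<in> carrier_vec n" "v \<noteq> 0\<^sub>v n" "A *\<^sub>v v = k \<cdot>\<^sub>v v"
    using ev A by (auto simp: eigenvalue_def eigenvector_def)
  have n: "n \<noteq> 0"
    using v by auto
  obtain i where i: "i < n" "\<And>j. j < n \<Longrightarrow> \<bar>v $ j\<bar> \<le> \<bar>v $ i\<bar>"
  proof -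
    let ?m = "Max ((\<lambda>j. \<bar>v $ j\<bar>) ` {..<n})"
    have "?m \<in> (\<lambda>j. \<bar>v $ j\<bar>) ` {..<n}"
      using n by (intro Max_in) auto
    then obtain i where "i < n" "?m = \<bar>v $ i\<bar>"
      by blast
    moreover have "\<bar>v $ j\<bar> \<le> ?m" if "j < n" for j
      using that by (intro Max_ge) auto
    ultimately show ?thesis
      by (intro that[of i]) simp_all
  qed
  have pos: "\<bar>v $ i\<bar> > 0"
  proof (rule ccontr)
    assume "\<not> \<bar>v $ i\<bar> > 0"
    then have "v $ j = 0" if "j < n" for j
      using i(2)[OF that] by auto
    with v(1) have "v = 0\<^sub>v n"
      by (intro eq_vecI) auto
    with v(2) show False by simp
  qed
  have "k * v $ i = (A *\<^sub>v v) $ i"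
    using v i(1) by simp
  also have "\<dots> = (\<Sum>j<n. A $$ (i, j) * v $ j)"
    using A v(1) i(1) by (simp add: scalar_prod_def atLeast0LessThan)
  finally have "\<bar>k\<bar> * \<bar>v $ i\<bar> = \<bar>\<Sum>j<n. A $$ (i, j) * v $ j\<bar>"
    by (simp flip: abs_mult)
  also have "\<dots> \<le> (\<Sum>j<n. \<bar>A $$ (i, j)\<bar> * \<bar>v $ i\<bar>)"
    by (rule order.trans[OF sum_abs])
       (auto simp: abs_mult intro!: sum_mono mult_left_mono i(2))
  also have "\<dots> \<le> s * \<bar>v $ i\<bar>"
    using rows[OF i(1)] by (simp add: mult_right_mono flip: sum_distrib_right)
  finally show ?thesis
    using pos by simp
qed

text \<open>Abstracts the adjacency matrix of a regular graph: the constant sums give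
  \<open>A J = J A = r J\<close>, and index 1 marks the eigenvalue belonging to the all-ones
  vector.\<close>

locale constant_row_sum =
  fixes A :: "real mat" and p :: nat and r :: real and l :: "nat \<Rightarrow> real"
  assumes A: "A \<in> carrier_mat p p"
    and row_sum: "\<And>i. i < p \<Longrightarrow> (\<Sum>k<p. A $$ (i, k)) = r"
    and col_sum: "\<And>j. j < p \<Longrightarrow> (\<Sum>k<p. A $$ (k, j)) = r"
    and char_poly_A: "char_poly A = (\<Prod>i=1..p. [:- l i, 1:])"
    and l1: "l 1 = r" and p_pos: "p > 0"
begin

text \<open>This is \<open>a A + b I + c J\<close>.\<close>

definition lin :: "real \<Rightarrow> real \<Rightarrow> real \<Rightarrow> real mat" where
  "lin a b c = mat p p (\<lambda>(i, j). a * A $$ (i, j) + b * of_bool (i = j) + c)"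

lemma lin_carrier [simp]: "lin a b c \<in> carrier_mat p p"
  by (simp add: lin_def)

text \<open>Since \<open>A J = J A = r J\<close> and \<open>J J = p J\<close>, the only new term in
  a product is \<open>A * A\<close>.\<close>

lemma lin_mult:
  "lin a b c * lin a' b' c' =
     (a * a') \<cdot>\<^sub>m (A * A) +
     lin (a * b' + b * a') (b * b') ((a * c' + c * a') * r + b * c' + b' * c + real p * c * c')"
proof (intro eq_matI)
  fix i j
  assume ij: "i < dim_row ((a * a') \<cdot>\<^sub>m (A * A) + lin (a * b' + b * a') (b * b')
                 ((a * c' + c * a') * r + b * c' + b' * c + real p * c * c'))"
             "j < dim_col ((a * a') \<cdot>\<^sub>m (A * A) + lin (a * b' + b * a') (b * b')
                 ((a * c' + c * a') * r + b * c' + b' * c + real p * c * c'))"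
  then have i: "i < p" and j: "j < p"
    by (simp_all add: lin_def)
  have *: "(\<Sum>k<p. f k * of_bool (i = k)) = f i" "(\<Sum>k<p. f k * of_bool (k = j)) = f j" for f :: "nat \<Rightarrow> real"
    using i j by (simp_all add: of_bool_def sum.delta sum.delta' if_distrib cong: if_cong)
  have "(lin a b c * lin a' b' c') $$ (i, j) =
      (\<Sum>k<p. (a * A $$ (i, k) + b * of_bool (i = k) + c) * (a' * A $$ (k, j) + b' * of_bool (k = j) + c'))"
    using i j by (simp add: lin_def scalar_prod_def atLeast0LessThan)
  also have "\<dots> = (\<Sum>k<p. a * a' * (A $$ (i, k) * A $$ (k, j))
      + (a * b' * A $$ (i, k)) * of_bool (k = j) + a * c' * A $$ (i, k)
      + (b * a' * A $$ (k, j)) * of_bool (i = k) + (b * b' * of_bool (k = j)) * of_bool (i = k)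
      + (b * c') * of_bool (i = k)
      + c * a' * A $$ (k, j) + (c * b') * of_bool (k = j) + c * c')"
    by (intro sum.cong) (simp_all add: algebra_simps)
  also have "\<dots> = a * a' * (\<Sum>k<p. A $$ (i, k) * A $$ (k, j))
      + a * b' * A $$ (i, j) + a * c' * r + b * a' * A $$ (i, j) + b * b' * of_bool (i = j) + b * c'
      + c * a' * r + c * b' + real p * (c * c')"
    using i j by (simp add: sum.distrib * row_sum col_sum flip: sum_distrib_left)
  also have "(\<Sum>k<p. A $$ (i, k) * A $$ (k, j)) = (A * A) $$ (i, j)"
    using A i j by (simp add: scalar_prod_def atLeast0LessThan)
  finally show "(lin a b c * lin a' b' c') $$ (i, j) = ((a * a') \<cdot>\<^sub>m (A * A) +
     lin (a * b' + b * a') (b * b') ((a * c' + c * a') * r + b * c' + b' * c + real p * c * c')) $$ (i, j)"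
    using A i j by (simp add: lin_def algebra_simps)
qed (use A in \<open>auto simp: lin_def\<close>)

lemma lin_cong: "a = a' \<Longrightarrow> b = b' \<Longrightarrow> c = c' \<Longrightarrow> lin a b c = lin a' b' c'"
  by simp

lemma lin_minus_lin:
  "(x \<cdot>\<^sub>m (A * A) + lin a b c) - (x' \<cdot>\<^sub>m (A * A) + lin a' b' c') =
    (x - x') \<cdot>\<^sub>m (A * A) + lin (a - a') (b - b') (c - c')"
  using A by (intro eq_matI) (auto simp: lin_def left_diff_distrib)

lemma lin_mult_commute: "lin a b c * lin a' b' c' = lin a' b' c' * lin a b c"
  by (simp add: lin_mult algebra_simps)

lemma det_lin: "det (lin 1 (- b) 0) = (\<Prod>i=1..p. l i - b)"
proof -
  have eq: "- char_matrix A b = (- 1) \<cdot>\<^sub>m lin 1 (- b) 0"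
    using A by (intro eq_matI) (auto simp: char_matrix_def lin_def)
  have "(- 1) ^ p * det (lin 1 (- b) 0) = poly (char_poly A) b"
    unfolding char_poly_matrix[OF A] eq by (simp add: det_smult lin_def)
  also have "\<dots> = (\<Prod>i=1..p. (- 1) * (l i - b))"
    by (simp add: char_poly_A poly_prod)
  also have "\<dots> = (- 1) ^ p * (\<Prod>i=1..p. l i - b)"
    by (subst prod.distrib) simp
  finally show ?thesis
    by simp
qed

lemma prod_eigenvalues: "(\<Prod>i=1..p. f (l i)) = f r * (\<Prod>i=2..p. f (l i))" for f :: "real \<Rightarrow> real"
  using p_pos l1 by (subst prod.atLeast_Suc_atMost) (auto simp: numeral_2_eq_2)

text \<open>Because \<open>(A - b I) J = (r - b) J\<close>, the matrix factors as
  \<open>(A - b I) (I + c J)\<close> with \<open>c = e / (r - b)\<close>.\<close>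

lemma det_lin_all_ones:
  assumes "b \<noteq> r"
  shows "det (lin 1 (- b) e) = (r - b + real p * e) * (\<Prod>i=2..p. l i - b)"
proof -
  define c where "c = e / (r - b)"
  have e: "e = c * (r - b)"
    using assms by (simp add: c_def)
  have "lin 1 (- b) 0 * lin 0 1 c = lin 1 (- b) e"
    unfolding lin_mult using A by (intro eq_matI) (auto simp: lin_def e algebra_simps)
  then have "det (lin 1 (- b) e) = det (lin 1 (- b) 0) * det (lin 0 1 c)"
    by (metis det_mult lin_carrier)
  also have "lin 0 1 c = mat p p (\<lambda>(i, j). of_bool (i = j) + c)"
    by (simp add: lin_def)
  finally show ?thesis
    unfolding det_lin det_one_plus_all_ones prod_eigenvalues[of "\<lambda>x. x - b"] e
    by (simp add: algebra_simps)
qed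

text \<open>On the orthogonal complement of the all-ones vector \<open>J\<close> vanishes, so only the eigenvalue \<open>r\<close>
  feels the term \<open>k J\<close>. The quadratic is split into linear factors to reduce to
  the characteristic polynomial of \<open>A\<close>.\<close>

lemma det_quadratic:
  fixes x y z :: real
  defines "Q \<equiv> \<lambda>t. x * t^2 + y * t + z"
  assumes "x \<noteq> 0" and disc: "y^2 - 4 * x * z \<ge> 0" and "Q r \<noteq> 0"
  shows "det (x \<cdot>\<^sub>m (A * A) + lin y z k) = (Q r + real p * k) * (\<Prod>i=2..p. Q (l i))"
proof -
  \<comment> \<open>The numbers \<open>a\<close> and \<open>b\<close> are the roots of
    \<open>Q\<close>, real by the assumption on the discriminant.\<close>
  define d where "d = sqrt (y^2 - 4 * x * z)"
  define a where "a = (- y + d) / (2 * x)"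
  define b where "b = (- y - d) / (2 * x)"
  have sum_ab: "x * (a + b) = - y"
    using \<open>x \<noteq> 0\<close> by (simp add: a_def b_def field_simps)
  have "d\<^sup>2 = y^2 - 4 * x * z"
    unfolding d_def using disc by simp
  moreover have "x * (a * b) = (y^2 - d^2) / (4 * x)"
    using \<open>x \<noteq> 0\<close> by (simp add: a_def b_def field_simps power2_eq_square)
  ultimately have prod_ab: "x * (a * b) = z"
    using \<open>x \<noteq> 0\<close> by simp
  have Q: "Q t = x * ((t - a) * (t - b))" for t
  proof -
    have "x * ((t - a) * (t - b)) = x * t^2 - x * (a + b) * t + x * (a * b)"
      by (simp add: algebra_simps power2_eq_square)
    then show ?thesis
      unfolding sum_ab prod_ab Q_def by simp
  qed
  have ab: "a \<noteq> r" "b \<noteq> r"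
    using \<open>Q r \<noteq> 0\<close> by (auto simp: Q)
  \<comment> \<open>Chosen so that \<open>x (A - a I) (e J) = k J\<close>: the second linear factor
    absorbs the all-ones term.\<close>
  define e where "e = k / (x * (r - a))"
  have k: "k = x * ((r - a) * e)"
    using ab \<open>x \<noteq> 0\<close> by (simp add: e_def)
  have "x \<cdot>\<^sub>m (A * A) + lin y z k = x \<cdot>\<^sub>m (lin 1 (- a) 0 * lin 1 (- b) e)"
    unfolding lin_mult
  proof (intro eq_matI)
    fix i j
    assume "i < dim_row (x \<cdot>\<^sub>m ((1 * 1) \<cdot>\<^sub>m (A * A) + lin (1 * - b + - a * 1) (- a * - b)
      ((1 * e + 0 * 1) * r + - a * e + - b * 0 + real p * 0 * e)))"
      "j < dim_col (x \<cdot>\<^sub>m ((1 * 1) \<cdot>\<^sub>m (A * A) + lin (1 * - b + - a * 1) (- a * - b)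
      ((1 * e + 0 * 1) * r + - a * e + - b * 0 + real p * 0 * e)))"
    then have ij: "i < p" "j < p"
      by (auto simp: lin_def)
    have y: "y = - (x * (a + b))"
      using sum_ab by simp
    show "(x \<cdot>\<^sub>m (A * A) + lin y z k) $$ (i, j) =
      (x \<cdot>\<^sub>m ((1 * 1) \<cdot>\<^sub>m (A * A) + lin (1 * - b + - a * 1) (- a * - b)
      ((1 * e + 0 * 1) * r + - a * e + - b * 0 + real p * 0 * e))) $$ (i, j)"
      using ij A unfolding y k prod_ab[symmetric] by (simp add: lin_def algebra_simps)
  qed (use A in \<open>auto simp: lin_def\<close>)
  also have "det \<dots> = x ^ p * (det (lin 1 (- a) 0) * det (lin 1 (- b) e))"
    by (subst det_smult, subst det_mult[OF lin_carrier lin_carrier]) (simp add: lin_def)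
  also have "det (lin 1 (- a) 0) = (r - a) * (\<Prod>i=2..p. l i - a)"
    unfolding det_lin by (rule prod_eigenvalues)
  also have "det (lin 1 (- b) e) = (r - b + real p * e) * (\<Prod>i=2..p. l i - b)"
    by (rule det_lin_all_ones[OF ab(2)])
  \<comment> \<open>One factor \<open>x\<close> goes to the eigenvalue \<open>r\<close>, the others
    to the remaining \<open>p - 1\<close> eigenvalues.\<close>
  also have "x ^ p = x * (\<Prod>i=2..p. x)"
    using p_pos by (cases p) auto
  finally have "det (x \<cdot>\<^sub>m (A * A) + lin y z k) =
      x * (r - a) * (r - b + real p * e) * ((\<Prod>i=2..p. x) * ((\<Prod>i=2..p. l i - a) * (\<Prod>i=2..p. l i - b)))"
    by (simp add: mult_ac)
  also have "(\<Prod>i=2..p. x) * ((\<Prod>i=2..p. l i - a) * (\<Prod>i=2..p. l i - b)) = (\<Prod>i=2..p. Q (l i))"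
    unfolding Q prod.distrib ..
  also have "x * (r - a) * (r - b + real p * e) = Q r + real p * k"
    by (simp add: Q k algebra_simps)
  finally show ?thesis .
qed

text \<open>The blocks commute, so the determinant is that of a quadratic in \<open>A\<close> plus a
  multiple of \<open>J\<close>. The bound on \<open>y\<close> makes its constant term
  \<open>z\<close> positive; with leading coefficient -6 the discriminant is then positive.\<close>

lemma det_four_block_lin:
  assumes y: "y > 2 * r" and r: "r > 0"
  shows "det (four_block_mat (lin (- 2) (y + 3) 0) (lin 2 (2 * r) (- 2 * r))
      (lin 0 2 (- 1)) (lin 3 (y + 3 * r) (- 3 * r / 2))) =
    ((y + 3 - 2 * r) * (y - 3 * (real p * r / 2 - 2 * r)) - 4 * (real p * r / 2 - r) * (real p - 2)) *
    (\<Prod>i=2..p. (y + 3 - 2 * l i) * (y + 3 * (l i + r)) - 4 * (l i + r))"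
proof -
  define z where "z = (y + 3) * (y + 3 * r) - 4 * r"
  define k where "k = 3 * r^2 - 3 * r / 2 * (y + 3) + 8 * r - 2 * r * real p"
  have z: "z > 0"
  proof -
    have "3 * (2 * r) \<le> (y + 3) * (y + 3 * r)"
      using y r by (intro mult_mono) auto
    then show ?thesis
      using r by (simp add: z_def)
  qed
  have Q: "(- 6) * t^2 + (y - 6 * r + 5) * t + z = (y + 3 - 2 * t) * (y + 3 * (t + r)) - 4 * (t + r)" for t
    by (simp add: z_def algebra_simps power2_eq_square)
  \<comment> \<open>The product of the two factors is at least \<open>24 * r\<close>, more than the
    subtracted \<open>4 * (r + r)\<close>.\<close>
  have Qr: "(- 6) * r^2 + (y - 6 * r + 5) * r + z \<noteq> 0"
  proof -
    have "3 * (8 * r) \<le> (y + 3 - 2 * r) * (y + 3 * (r + r))"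
      using y r by (intro mult_mono) auto
    then show ?thesis
      unfolding Q using r by simp
  qed
  have "det (four_block_mat (lin (- 2) (y + 3) 0) (lin 2 (2 * r) (- 2 * r))
      (lin 0 2 (- 1)) (lin 3 (y + 3 * r) (- 3 * r / 2))) =
    det (lin (- 2) (y + 3) 0 * lin 3 (y + 3 * r) (- 3 * r / 2) - lin 2 (2 * r) (- 2 * r) * lin 0 2 (- 1))"
    by (rule det_four_block_mat[OF _ _ _ _ lin_mult_commute, of _ p]) auto
  also have "lin (- 2) (y + 3) 0 * lin 3 (y + 3 * r) (- 3 * r / 2) - lin 2 (2 * r) (- 2 * r) * lin 0 2 (- 1)
      = (- 6) \<cdot>\<^sub>m (A * A) + lin (y - 6 * r + 5) z k"
    unfolding lin_mult lin_minus_lin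
    by (intro arg_cong2[of _ _ _ _ "(+)"] arg_cong2[of _ _ _ _ "(\<cdot>\<^sub>m)"] lin_cong)
       (simp_all add: z_def k_def algebra_simps power2_eq_square)
  also have "det \<dots> = ((- 6) * r^2 + (y - 6 * r + 5) * r + z + real p * k)
      * (\<Prod>i=2..p. (- 6) * (l i)^2 + (y - 6 * r + 5) * l i + z)"
    using z Qr by (intro det_quadratic) auto
  also have "(- 6) * r^2 + (y - 6 * r + 5) * r + z + real p * k =
      (y + 3 - 2 * r) * (y - 3 * (real p * r / 2 - 2 * r)) - 4 * (real p * r / 2 - r) * (real p - 2)"
    by (simp add: z_def k_def field_simps power2_eq_square)
  finally show ?thesis
    unfolding Q .
qed

end

section \<open>Matrices indexed by lists and roots of quadratics\<close>

text \<open>Indexing by elements instead of positions turns matrix products into sums over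
  sets.\<close>

definition index_mat :: "'a list \<Rightarrow> 'b list \<Rightarrow> ('a \<Rightarrow> 'b \<Rightarrow> 'c) \<Rightarrow> 'c mat" where
  "index_mat xs ys f = mat (length xs) (length ys) (\<lambda>(i, j). f (xs ! i) (ys ! j))"

lemma sum_nth_eq_sum_set:
  fixes f :: "'a \<Rightarrow> 'b::comm_monoid_add"
  shows "distinct xs \<Longrightarrow> (\<Sum>i<length xs. f (xs ! i)) = (\<Sum>x\<in>set xs. f x)"
  by (rule sum.reindex_bij_betw) (rule bij_betw_nth, auto)

lemma index_mat_mult:
  fixes f :: "'a \<Rightarrow> 'b \<Rightarrow> 'd::comm_semiring_1"
  assumes "distinct ys"
  shows "index_mat xs ys f * index_mat ys zs g = index_mat xs zs (\<lambda>x z. \<Sum>y\<in>set ys. f x y * g y z)"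
proof (intro eq_matI)
  fix i j
  assume "i < dim_row (index_mat xs zs (\<lambda>x z. \<Sum>y\<in>set ys. f x y * g y z))"
    "j < dim_col (index_mat xs zs (\<lambda>x z. \<Sum>y\<in>set ys. f x y * g y z))"
  then show "(index_mat xs ys f * index_mat ys zs g) $$ (i, j) =
      index_mat xs zs (\<lambda>x z. \<Sum>y\<in>set ys. f x y * g y z) $$ (i, j)"
    using sum_nth_eq_sum_set[OF assms, of "\<lambda>y. f (xs ! i) y * g y (zs ! j)"]
    by (simp add: index_mat_def scalar_prod_def atLeast0LessThan)
qed (simp_all add: index_mat_def)

lemma repeat_mset_single: "repeat_mset n {#x#} = replicate_mset n x"
  by (induction n) auto

lemma quadratic_from_roots:
  fixes s d x :: real
  assumes "d \<ge> 0"
  shows "(x - (s + sqrt d) / 2) * (x - (s - sqrt d) / 2) = ((2 * x - s)^2 - d) / 4"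
proof -
  have "sqrt d * sqrt d = d"
    using assms by simp
  then show ?thesis
    by (simp add: field_simps power2_eq_square)
qed

section \<open>Factorization of the eccentricity matrix\<close>

context regular_triangle_free
begin

lemma verts_C: "verts C = V <+> E"
  by (simp add: verts_central_graph Plus_def)

text \<open>With respect to the splitting of the vertices of \<open>C\<close> into \<open>V\<close> and \<open>E\<close>, and with \<open>B\<close> the vertex-edge
  incidence matrix, the eccentricity matrix is \<open>[2 A, 2 (J - B); 2 (J - B)\<^sup>T, 3 (J + I - B\<^sup>T B)]\<close>.
  Every column of \<open>B\<close> sums to 2, so each all-ones block is a multiple of \<open>J B\<close>, \<open>B\<^sup>T J\<close> or \<open>B\<^sup>T J B\<close>;
  hence the matrix minus \<open>3 I\<close> factors through \<open>diag(I, B\<^sup>T)\<close>, the left factor below.\<close>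

fun left_factor :: "'a + 'a set \<Rightarrow> 'a + 'a \<Rightarrow> real" where
  "left_factor (Inl u) (Inl v) = of_bool (u = v)"
| "left_factor (Inl u) (Inr v) = 0"
| "left_factor (Inr e) (Inl v) = 0"
| "left_factor (Inr e) (Inr v) = of_bool (v \<in> e)"

text \<open>The blocks are \<open>2 A - 3 I\<close>, \<open>2 (J - B)\<close>,
  \<open>J - 2 I\<close> and \<open>3/2 J - 3 B\<close>. The constants 1 and 3/2 in the lower blocks
  are doubled by summing over the two endpoints of an edge.\<close>

fun right_factor :: "'a + 'a \<Rightarrow> 'a + 'a set \<Rightarrow> real" where
  "right_factor (Inl v) (Inl u) = 2 * of_bool (adj G v u) - 3 * of_bool (v = u)"
| "right_factor (Inl v) (Inr e) = 2 - 2 * of_bool (v \<in> e)"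
| "right_factor (Inr v) (Inl u) = 1 - 2 * of_bool (v = u)"
| "right_factor (Inr v) (Inr e) = 3 / 2 - 3 * of_bool (v \<in> e)"

text \<open>The right factor times the left factor, simplified by
  \<open>B B\<^sup>T = A + r I\<close> and \<open>J B\<^sup>T = r J\<close>.\<close>

fun swapped_product :: "'a + 'a \<Rightarrow> 'a + 'a \<Rightarrow> real" where
  "swapped_product (Inl v) (Inl w) = 2 * of_bool (adj G v w) - 3 * of_bool (v = w)"
| "swapped_product (Inl v) (Inr w) = 2 * real r - 2 * of_bool (adj G v w) - 2 * real r * of_bool (v = w)"
| "swapped_product (Inr v) (Inl w) = 1 - 2 * of_bool (v = w)"
| "swapped_product (Inr v) (Inr w) = 3 * real r / 2 - 3 * of_bool (adj G v w) - 3 * real r * of_bool (v = w)"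

lemma V_Int_edge: "e \<in> E \<Longrightarrow> V \<inter> e = e"
  using edge_subset by auto

lemma card_edge_inter:
  assumes "e \<in> E" "f \<in> E" "e \<noteq> f"
  shows "card (e \<inter> f) = of_bool (e \<inter> f \<noteq> {})"
proof -
  have "e \<noteq> e \<inter> f"
    using assms card_subset_eq[OF finite_edge[OF assms(2)], of e]
    by (auto simp: card_edge)
  then have "e \<inter> f \<subset> e"
    by auto
  then have "card (e \<inter> f) < 2"
    using psubset_card_mono[OF finite_edge[OF assms(1)]] card_edge[OF assms(1)] by metis
  moreover have "card (e \<inter> f) = 0 \<longleftrightarrow> e \<inter> f = {}"
    using finite_edge[OF assms(1)] by simp
  ultimately show ?thesis
    by (cases "e \<inter> f = {}") auto
qed

text \<open>Distinct edges share at most one vertex, so \<open>3 - 3 * card (e \<inter> f)\<close>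
  is 3 or 0 off the diagonal; on it the value is -3, matching the subtracted
  \<open>3 I\<close>.\<close>

lemma left_right:
  assumes "x \<in> verts C" "y \<in> verts C"
  shows "(\<Sum>z\<in>V <+> V. left_factor x z * right_factor z y) = ecc_entry x y - 3 * of_bool (x = y)"
proof -
  have ecc_Inr_Inr: "(\<Sum>v\<in>e. 3 / 2 - 3 * of_bool (v \<in> f) :: real) = 3 * of_bool (e \<inter> f = {}) - 3 * of_bool (e = f)"
    if "e \<in> E" "f \<in> E" for e f
  proof -
    have "(\<Sum>v\<in>e. 3 / 2 - 3 * of_bool (v \<in> f) :: real) = 3 - 3 * real (card (e \<inter> f))"
      using that by (simp add: sum_subtractf card_edge finite_edge flip: sum_distrib_left)
    moreover have "e \<noteq> {}"
      using card_edge[OF that(1)] by auto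
    ultimately show ?thesis
      using card_edge_inter[OF that] card_edge[OF that(1)] by (cases "e = f") auto
  qed
  have ecc_Inr_Inl: "(\<Sum>v\<in>e. 1 - 2 * of_bool (v = u) :: real) = 2 * of_bool (u \<notin> e)"
    if "e \<in> E" for e u
  proof -
    have "e \<inter> {u} = (if u \<in> e then {u} else {})"
      by auto
    then show ?thesis
      using that by (simp add: sum_subtractf card_edge finite_edge flip: sum_distrib_left)
  qed
  show ?thesis
  proof (cases x)
    case (Inl u)
    then show ?thesis
      using assms by (cases y) (auto simp: verts_C sum.Plus finite_V)
  next
    case (Inr e)
    then have "e \<in> E" and "\<And>f. y = Inr f \<Longrightarrow> f \<in> E"
      using assms by (auto simp: verts_C)
    with Inr show ?thesis
      by (cases y) (simp_all add: sum.Plus finite_V V_Int_edge ecc_Inr_Inr ecc_Inr_Inl)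
  qed
qed

lemma right_left:
  assumes "z \<in> V <+> V" "z' \<in> V <+> V"
  shows "(\<Sum>x\<in>verts C. right_factor z x * left_factor x z') = swapped_product z z'"
proof -
  have *: "(\<Sum>e\<in>E \<inter> {e. w \<in> e}. a - b * of_bool (v \<in> e)) =
      a * real r - b * (of_bool (adj G v w) + real r * of_bool (v = w))"
    if "v \<in> V" "w \<in> V" for v w and a b :: real
  proof -
    have "(\<Sum>e\<in>E \<inter> {e. w \<in> e}. a - b * of_bool (v \<in> e)) =
        a * real (card {e \<in> E. w \<in> e}) - b * real (card {e \<in> E. v \<in> e \<and> w \<in> e})"
      by (simp add: sum_subtractf finite_E Collect_conj_eq Int_ac flip: sum_distrib_left)
    then show ?thesis
      using that adj_irrefl by (cases "v = w") (simp_all add: card_incident_edges card_common_edges)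
  qed
  have "card (E \<inter> {e. v \<in> e}) = r" if "v \<in> V" for v
    using card_incident_edges[OF that] by (simp add: Collect_conj_eq)
  then show ?thesis
    using assms
    by (cases z; cases z')
       (auto simp: verts_C sum.Plus finite_V finite_E adj_irrefl * )
qed

lemma card_verts_C: "card (verts C) = p + q"
  by (simp add: verts_C card_Plus finite_V finite_E p q)

end

section \<open>The characteristic polynomial and the spectrum\<close>

locale enumerated_regular_triangle_free = regular_triangle_free G r p q
  for G :: "'a graph" and r p q +
  fixes vs :: "'a list" and ws :: "('a + 'a set) list" and l :: "nat \<Rightarrow> real"
  assumes vs: "vertex_enum G vs" and ws: "vertex_enum C ws"
    and eig: "eigenvalue_mset (adjacency_matrix G vs) = image_mset l (mset_set {1..p})"
    and l1: "l 1 = real r"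
begin

lemma length_vs: "length vs = p" and length_ws: "length ws = p + q"
  using vs ws distinct_card[of vs] distinct_card[of ws] card_verts_C
  by (simp_all add: vertex_enum_def p)

lemma nth_vs: "i < p \<Longrightarrow> vs ! i \<in> V"
  using vs length_vs nth_mem by (force simp: vertex_enum_def)

lemma sum_vs: "(\<Sum>k<p. f (vs ! k)) = (\<Sum>v\<in>V. f v)" for f :: "'a \<Rightarrow> real"
  using sum_nth_eq_sum_set[of vs f] vs length_vs by (simp add: vertex_enum_def)

abbreviation "A \<equiv> adjacency_matrix G vs"

lemma adjacency_carrier: "A \<in> carrier_mat p p"
  by (simp add: adjacency_matrix_def length_vs)

lemma adjacency_entry: "i < p \<Longrightarrow> j < p \<Longrightarrow> A $$ (i, j) = of_bool (adj G (vs ! i) (vs ! j))"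
  by (simp add: adjacency_matrix_def length_vs)

lemma adjacency_row_sum:
  assumes "i < p"
  shows "(\<Sum>k<p. A $$ (i, k)) = real r"
proof -
  have "(\<Sum>k<p. A $$ (i, k)) = (\<Sum>k<p. of_bool (adj G (vs ! i) (vs ! k)))"
    using assms by (simp add: adjacency_entry)
  also have "\<dots> = real (card {v \<in> V. adj G (vs ! i) v})"
    using sum_vs[of "\<lambda>v. of_bool (adj G (vs ! i) v)"] by (simp add: finite_V Collect_conj_eq)
  finally show ?thesis
    using degree_eq[OF nth_vs[OF assms]] by simp
qed

text \<open>The eigenvalue multiset has \<open>p\<close> elements, the degree of this monic
  polynomial, which therefore splits.\<close>

lemma char_poly_adjacency: "char_poly A = (\<Prod>i=1..p. [:- l i, 1:])"
proof -
  have "size (proots (char_poly A)) = degree (char_poly A)" "lead_coeff (char_poly A) = 1"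
    using eig degree_monic_char_poly[OF adjacency_carrier]
    by (auto simp: eigenvalue_mset_def)
  then show ?thesis
    using poly_eq_smult_prod_proots[of "char_poly A"] eig
    by (simp add: eigenvalue_mset_def prod_unfold_prod_mset image_mset.compositionality comp_def)
qed

text \<open>The row sums bound every eigenvalue by \<open>r\<close> in absolute value. This makes
  the numbers under the square roots nonnegative.\<close>

lemma eigenvalue_plus_degree_nonneg:
  assumes "i \<in> {1..p}"
  shows "l i + real r \<ge> 0"
proof -
  have "poly (char_poly A) (l i) = 0"
    using assms by (auto simp: char_poly_adjacency poly_prod)
  then have "eigenvalue A (l i)"
    using eigenvalue_root_char_poly[OF adjacency_carrier] by simp
  then have "\<bar>l i\<bar> \<le> real r"
    by (rule abs_eigenvalue_le_row_sum[OF adjacency_carrier])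
       (simp add: adjacency_entry flip: adjacency_row_sum)
  then show ?thesis by simp
qed

sublocale crs: constant_row_sum A p "real r" l
proof
  have "A $$ (i, k) = A $$ (k, i)" if "i < p" "k < p" for i k
    using that adj_sym by (simp add: adjacency_entry)
  then show "(\<Sum>k<p. A $$ (k, j)) = real r" if "j < p" for j
    using that adjacency_row_sum[OF that] by simp
qed (use adjacency_carrier adjacency_row_sum char_poly_adjacency l1 r_less_p in auto)

text \<open>For such \<open>x\<close> the number \<open>y = x - 3\<close> exceeds
  \<open>2 * r\<close>, so the block determinant formula applies and powers of \<open>y\<close> can
  be cancelled.\<close>

lemma poly_char_poly_eccentricity:
  assumes "x > 2 * real r + 3"
  shows "poly (char_poly (eccentricity_matrix C ws)) x = (x - 3) ^ (q - p) *
    (((x - 2 * r) * (x - 3 - 3 * (real q - 2 * real r)) - 4 * (real q - r) * (real p - 2)) *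
     (\<Prod>i=2..p. (x - 2 * l i) * (x - 3 + 3 * (l i + r)) - 4 * (l i + r)))"
proof -
  define y where "y = x - 3"
  have y: "y > 2 * real r" "y > 0" and r: "real r > 0"
    using assms r2 by (simp_all add: y_def)
  \<comment> \<open>Two copies of the vertex list index the inner dimension \<open>2p\<close> of the
    factorization.\<close>
  define us where "us = map Inl vs @ map (Inr :: 'a \<Rightarrow> 'a + 'a) vs"
  have us: "distinct us" "set us = V <+> V" "length us = p + p"
    using vs length_vs by (auto simp: us_def vertex_enum_def distinct_map Plus_def)
  have dws: "distinct ws" "set ws = verts C"
    using ws by (simp_all add: vertex_enum_def)
  define L where "L = index_mat ws us left_factor"
  define S where "S = index_mat us ws right_factor"
  have L: "L \<in> carrier_mat (p + q) (p + p)" and S: "S \<in> carrier_mat (p + p) (p + q)"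
    by (simp_all add: L_def S_def index_mat_def us length_ws)
  have M: "eccentricity_matrix C ws \<in> carrier_mat (p + q) (p + q)"
    by (simp add: eccentricity_matrix_def length_ws)
  have nth_ws: "ws ! i \<in> verts C" if "i < p + q" for i
    using that dws length_ws nth_mem by metis
  have "- char_matrix (eccentricity_matrix C ws) x = y \<cdot>\<^sub>m 1\<^sub>m (p + q) - L * S"
    unfolding L_def S_def index_mat_mult[OF us(1)] eccentricity_matrix_central[OF dws(2)]
    using dws(1)
    by (intro eq_matI)
       (auto simp: index_mat_def char_matrix_def length_ws us(2) left_right nth_ws y_def nth_eq_iff_index_eq)
  then have poly_eq: "poly (char_poly (eccentricity_matrix C ws)) x = det (y \<cdot>\<^sub>m 1\<^sub>m (p + q) - L * S)"
    using char_poly_matrix[OF M] by simp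
  have "y \<cdot>\<^sub>m 1\<^sub>m (p + p) - S * L = four_block_mat (crs.lin (- 2) (y + 3) 0) (crs.lin 2 (2 * r) (- 2 * r))
      (crs.lin 0 2 (- 1)) (crs.lin 3 (y + 3 * r) (- 3 * r / 2))" (is "?lhs = ?rhs")
  proof (intro eq_matI)
    fix i j
    assume "i < dim_row ?rhs" "j < dim_col ?rhs"
    then have ij: "i < p + p" "j < p + p"
      by (simp_all add: crs.lin_def)
    have nth_us: "us ! k = (if k < p then Inl (vs ! k) else Inr (vs ! (k - p)))" if "k < p + p" for k
      using that by (simp add: us_def nth_append length_vs)
    have mem_us: "us ! k \<in> V <+> V" if "k < p + p" for k
      using that us nth_mem by metis
    have inj: "vs ! k = vs ! k' \<longleftrightarrow> k = k'" if "k < p" "k' < p" for k k'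
      using that vs by (simp add: vertex_enum_def nth_eq_iff_index_eq length_vs)
    have diff: "i - p = j - p \<longleftrightarrow> i = j" if "\<not> i < p" "\<not> j < p"
      using that by auto
    have "?lhs $$ (i, j) = y * of_bool (i = j) - swapped_product (us ! i) (us ! j)"
      unfolding L_def S_def index_mat_mult[OF dws(1)]
      using ij by (simp add: index_mat_def us(3) dws(2) right_left mem_us)
    also have "\<dots> = ?rhs $$ (i, j)"
      using ij
      by (cases "i < p"; cases "j < p")
         (simp_all add: nth_us crs.lin_def adjacency_entry inj diff adj_irrefl algebra_simps)
    finally show "?lhs $$ (i, j) = ?rhs $$ (i, j)" .
  qed (use S L in \<open>auto simp: crs.lin_def\<close>)
  then have swapped: "det (y \<cdot>\<^sub>m 1\<^sub>m (p + p) - S * L) =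
      ((y + 3 - 2 * r) * (y - 3 * (real p * r / 2 - 2 * r)) - 4 * (real p * r / 2 - r) * (real p - 2)) *
      (\<Prod>i=2..p. (y + 3 - 2 * l i) * (y + 3 * (l i + r)) - 4 * (l i + r))"
    using crs.det_four_block_lin[OF y(1) r] by simp
  have q_eq: "real p * real r / 2 = real q"
    using arg_cong[OF handshake, of real] by simp
  have "y ^ (p + p) * det (y \<cdot>\<^sub>m 1\<^sub>m (p + q) - L * S) = y ^ (p + q) * det (y \<cdot>\<^sub>m 1\<^sub>m (p + p) - S * L)"
    by (rule sylvester_det_identity[OF L S])
  \<comment> \<open>Splitting off \<open>y ^ (p + p)\<close>, possible as \<open>p \<le> q\<close>,
    leaves the power that yields the eigenvalue 3.\<close>
  also have "y ^ (p + q) = y ^ (p + p) * y ^ (q - p)"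
    using p_le_q by (simp flip: power_add)
  finally have "det (y \<cdot>\<^sub>m 1\<^sub>m (p + q) - L * S) = y ^ (q - p) * det (y \<cdot>\<^sub>m 1\<^sub>m (p + p) - S * L)"
    using y(2) by simp
  then show ?thesis
    unfolding poly_eq swapped q_eq by (simp add: y_def)
qed

lemma eigenvalues_eccentricity_central:
  "eigenvalue_mset (eccentricity_matrix C ws) =
      replicate_mset (q - p) 3
    + (\<Sum>i=2..p.
        {# ((3 - (3 * real r + l i)) + sqrt ((5 * l i + 3 * (real r - 1))^2 + 16 * (l i + real r))) / 2,
           ((3 - (3 * real r + l i)) - sqrt ((5 * l i + 3 * (real r - 1))^2 + 16 * (l i + real r))) / 2 #})
    + {# ((3 * real q - 4 * real r + 3)
           + sqrt ((3 * real q - 8 * real r + 3)^2 + 16 * (real p - 2) * (real q - real r))) / 2,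
         ((3 * real q - 4 * real r + 3)
           - sqrt ((3 * real q - 8 * real r + 3)^2 + 16 * (real p - 2) * (real q - real r))) / 2 #}"
proof -
  define s where "s i = 3 - (3 * real r + l i)" for i
  define d where "d i = (5 * l i + 3 * (real r - 1))^2 + 16 * (l i + real r)" for i
  define s' where "s' = 3 * real q - 4 * real r + 3"
  define d' where "d' = (3 * real q - 8 * real r + 3)^2 + 16 * (real p - 2) * (real q - real r)"
  \<comment> \<open>\<open>F s d\<close> is the monic quadratic with roots
    \<open>(s + sqrt d) / 2\<close> and \<open>(s - sqrt d) / 2\<close>; \<open>R\<close> is the
    expected characteristic polynomial.\<close>
  define F where "F s d = [:- ((s + sqrt d) / 2), 1:] * [:- ((s - sqrt d) / 2), 1:]" for s d
  define R where "R = [:- 3, 1:] ^ (q - p) * (F s' d' * (\<Prod>i=2..p. F (s i) (d i)))"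
  have F: "poly (F s d) x = ((2 * x - s)^2 - d) / 4" if "d \<ge> 0" for s d x
  proof -
    have *: "poly ([:- a, 1:] * [:- b, 1:]) x = (x - a) * (x - b)" for a b :: real
      by (simp add: algebra_simps)
    show ?thesis
      unfolding F_def * by (rule quadratic_from_roots[OF that])
  qed
  have Fi: "poly (F (s i) (d i)) x = (x - 2 * l i) * (x - 3 + 3 * (l i + r)) - 4 * (l i + r)"
    if "i \<in> {2..p}" for i x
  proof -
    have "d i \<ge> 0"
      using eigenvalue_plus_degree_nonneg[of i] that by (simp add: d_def)
    then show ?thesis
      by (simp add: F s_def d_def field_simps power2_eq_square)
  qed
  have F': "poly (F s' d') x =
      (x - 2 * r) * (x - 3 - 3 * (real q - 2 * real r)) - 4 * (real q - r) * (real p - 2)" for x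
  proof -
    have "d' \<ge> 0"
      using r_less_p r_le_q r2 by (simp add: d'_def)
    then show ?thesis
      by (simp add: F s'_def d'_def field_simps power2_eq_square)
  qed
  \<comment> \<open>Both polynomials agree for all \<open>x > 2 * r + 3\<close>, so their difference
    has infinitely many roots and vanishes.\<close>
  have "char_poly (eccentricity_matrix C ws) = R"
  proof (rule ccontr)
    assume "char_poly (eccentricity_matrix C ws) \<noteq> R"
    then have "finite {x. poly (char_poly (eccentricity_matrix C ws) - R) x = 0}"
      by (intro poly_roots_finite) simp
    moreover have "{2 * real r + 3<..} \<subseteq> {x. poly (char_poly (eccentricity_matrix C ws) - R) x = 0}"
      using F' Fi by (auto simp: poly_char_poly_eccentricity R_def poly_prod poly_power)
    ultimately show False
      using infinite_Ioi finite_subset by blast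
  qed
  moreover have F_nz: "F s d \<noteq> 0" for s d
    by (simp add: F_def)
  moreover have "proots (F s d) = {# (s + sqrt d) / 2, (s - sqrt d) / 2 #}" for s d
    unfolding F_def by (subst proots_mult) simp_all
  ultimately have "eigenvalue_mset (eccentricity_matrix C ws) =
      repeat_mset (q - p) {#3#} +
      ({# (s' + sqrt d') / 2, (s' - sqrt d') / 2 #} +
       (\<Sum>i=2..p. {# (s i + sqrt (d i)) / 2, (s i - sqrt (d i)) / 2 #}))"
    by (simp add: eigenvalue_mset_def R_def proots_mult proots_power proots_prod)
  then show ?thesis
    by (simp add: repeat_mset_single s_def d_def s'_def d'_def union_ac)
qed

end

theorem theorem3p1:
  fixes G :: "'a graph" and r p q :: nat and l :: "nat \<Rightarrow> real"
    and vs :: "'a list" and ws :: "('a + 'a set) list"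
  assumes "simple_graph G" and "connected_graph G" and "triangle_free G"
    and "regular_graph G r" and "r \<ge> 2"
    and "p = card (verts G)" and "q = card (edges G)"
    and "vertex_enum G vs" and "vertex_enum (central_graph G) ws"
    and "eigenvalue_mset (adjacency_matrix G vs) = image_mset l (mset_set {1..p})"
    and "l 1 = real r" and "l 2 < l 1"
    and "\<And>i j. 2 \<le> i \<Longrightarrow> i \<le> j \<Longrightarrow> j \<le> p \<Longrightarrow> l j \<le> l i"
  shows "eigenvalue_mset (eccentricity_matrix (central_graph G) ws) =
      replicate_mset (q - p) 3
    + (\<Sum>i=2..p.
        {# ((3 - (3 * real r + l i)) + sqrt ((5 * l i + 3 * (real r - 1))^2 + 16 * (l i + real r))) / 2,
           ((3 - (3 * real r + l i)) - sqrt ((5 * l i + 3 * (real r - 1))^2 + 16 * (l i + real r))) / 2 #})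
    + {# ((3 * real q - 4 * real r + 3)
           + sqrt ((3 * real q - 8 * real r + 3)^2 + 16 * (real p - 2) * (real q - real r))) / 2,
         ((3 * real q - 4 * real r + 3)
           - sqrt ((3 * real q - 8 * real r + 3)^2 + 16 * (real p - 2) * (real q - real r))) / 2 #}"
proof -
  interpret enumerated_regular_triangle_free G r p q vs ws l
    using assms by unfold_locales (auto simp: connected_graph_def)
  show ?thesis
    by (rule eigenvalues_eccentricity_central)
qed

end
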